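(* Let $L=\langle R_i:i\in I\rangle$ be a relational language with $\operatorname{ar}(R_i)=n_i\in\mathbb N$, let $X\neq\emptyset$, and let $\mathcal C\subseteq \operatorname{Int}_L(X)$ be an isomorphism-invariant set. Let $\tau\in\operatorname{Max}\mathcal C$ (respectively, $\tau\in\operatorname{Min}\mathcal C$). Then: (a) $\tau$ is a reversible interpretation; (b) $[\tau]_{\cong}=[\tau]_{\sim_c}$, this set is an antichain in $\langle\mathcal C,\subseteq\rangle$, and $[\tau]_{\cong}\subseteq\operatorname{Max}\mathcal C$ (respectively, $[\tau]_{\cong}\subseteq\operatorname{Min}\mathcal C$); (c) the set $\mathcal C^c=\{\rho^c:\rho\in\mathcal C\}$ is isomorphism-invariant, and for every $\tau\in\operatorname{Int}_L(X)$ we have $\tau\in\operatorname{Max}\mathcal C$ iff $\tau^c\in\operatorname{Min}(\mathcal C^c)$.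
   Context: $\operatorname{Int}_L(X)=\prod_{i\in I}P(X^{n_i})$ is the set of all interpretations $\rho=\langle\rho_i:i\in I\rangle$ of $L$ on $X$. For $\rho,\sigma\in\operatorname{Int}_L(X)$ write $\rho\subseteq\sigma$ iff $\rho_i\subseteq\sigma_i$ for all $i$; $\rho^c=\langle X^{n_i}\setminus\rho_i:i\in I\rangle$. $\operatorname{Max}\mathcal C$, $\operatorname{Min}\mathcal C$ denote the maximal, minimal elements of $\langle\mathcal C,\subseteq\rangle$. Write $\rho\cong\sigma$ iff the structures $\langle X,\rho\rangle$ and $\langle X,\sigma\rangle$ are isomorphic, and $[\rho]_\cong=\{\sigma\in\operatorname{Int}_L(X):\sigma\cong\rho\}$. A set $\mathcal C$ is isomorphism-invariant iff $[\rho]_\cong\subseteq\mathcal C$ for all $\rho\in\mathcal C$. A condensation is a bijective homomorphism; $\rho\preccurlyeq_c\sigma$ iff there is a condensation $\langle X,\rho\rangle\to\langle X,\sigma\rangle$; $\rho\sim_c\sigma$ iff $\rho\preccurlyeq_c\sigma$ and $\sigma\preccurlyeq_c\rho$; $[\rho]_{\sim_c}=\{\sigma:\sigma\sim_c\rho\}$. An interpretation $\rho$ is reversible iff every condensation of $\langle X,\rho\rangle$ onto itself is an automorphism. *)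

theory Defs
  imports "HOL-Library.FuncSet" "HOL-Library.NList"
begin

(* A relational language is given by a set I of relation symbols and an arity function ar on I.
   The power X^n is the set nlists n X of lists of length n with entries in X; arity 0 is allowed.
   Interpretations are extensional outside I, so that equality of interpretations is equality of
   the indexed families. *)

definition Interps :: "'i set \<Rightarrow> ('i \<Rightarrow> nat) \<Rightarrow> 'a set \<Rightarrow> ('i \<Rightarrow> 'a list set) set" where
  "Interps I ar X = (\<Pi>\<^sub>E i\<in>I. Pow (nlists (ar i) X))"

definition interp_le :: "'i set \<Rightarrow> ('i \<Rightarrow> 'a list set) \<Rightarrow> ('i \<Rightarrow> 'a list set) \<Rightarrow> bool" where
  "interp_le I \<rho> \<sigma> \<longleftrightarrow> (\<forall>i\<in>I. \<rho> i \<subseteq> \<sigma> i)"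

definition interp_compl ::
  "'i set \<Rightarrow> ('i \<Rightarrow> nat) \<Rightarrow> 'a set \<Rightarrow> ('i \<Rightarrow> 'a list set) \<Rightarrow> ('i \<Rightarrow> 'a list set)" where
  "interp_compl I ar X \<rho> = (\<lambda>i\<in>I. nlists (ar i) X - \<rho> i)"

definition Max_interps :: "'i set \<Rightarrow> ('i \<Rightarrow> 'a list set) set \<Rightarrow> ('i \<Rightarrow> 'a list set) set" where
  "Max_interps I C = {\<tau> \<in> C. \<forall>\<sigma>\<in>C. interp_le I \<tau> \<sigma> \<longrightarrow> \<sigma> = \<tau>}"

definition Min_interps :: "'i set \<Rightarrow> ('i \<Rightarrow> 'a list set) set \<Rightarrow> ('i \<Rightarrow> 'a list set) set" where
  "Min_interps I C = {\<tau> \<in> C. \<forall>\<sigma>\<in>C. interp_le I \<sigma> \<tau> \<longrightarrow> \<sigma> = \<tau>}"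

definition antichain_in :: "'i set \<Rightarrow> ('i \<Rightarrow> 'a list set) set \<Rightarrow> ('i \<Rightarrow> 'a list set) set \<Rightarrow> bool" where
  "antichain_in I C A \<longleftrightarrow>
     A \<subseteq> C \<and> (\<forall>\<rho>\<in>A. \<forall>\<sigma>\<in>A. \<rho> \<noteq> \<sigma> \<longrightarrow> \<not> interp_le I \<rho> \<sigma> \<and> \<not> interp_le I \<sigma> \<rho>)"

definition homomorphism ::
  "'i set \<Rightarrow> ('i \<Rightarrow> nat) \<Rightarrow> 'a set \<Rightarrow> ('i \<Rightarrow> 'a list set) \<Rightarrow> 'b set \<Rightarrow> ('i \<Rightarrow> 'b list set) \<Rightarrow>
     ('a \<Rightarrow> 'b) \<Rightarrow> bool" where
  "homomorphism I ar X \<rho> Y \<sigma> f \<longleftrightarrow>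
     f \<in> X \<rightarrow> Y \<and> (\<forall>i\<in>I. \<forall>xs\<in>nlists (ar i) X. xs \<in> \<rho> i \<longrightarrow> map f xs \<in> \<sigma> i)"

definition condensation ::
  "'i set \<Rightarrow> ('i \<Rightarrow> nat) \<Rightarrow> 'a set \<Rightarrow> ('i \<Rightarrow> 'a list set) \<Rightarrow> 'b set \<Rightarrow> ('i \<Rightarrow> 'b list set) \<Rightarrow>
     ('a \<Rightarrow> 'b) \<Rightarrow> bool" where
  "condensation I ar X \<rho> Y \<sigma> f \<longleftrightarrow> bij_betw f X Y \<and> homomorphism I ar X \<rho> Y \<sigma> f"

definition isomorphism ::
  "'i set \<Rightarrow> ('i \<Rightarrow> nat) \<Rightarrow> 'a set \<Rightarrow> ('i \<Rightarrow> 'a list set) \<Rightarrow> 'b set \<Rightarrow> ('i \<Rightarrow> 'b list set) \<Rightarrow>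
     ('a \<Rightarrow> 'b) \<Rightarrow> bool" where
  "isomorphism I ar X \<rho> Y \<sigma> f \<longleftrightarrow>
     bij_betw f X Y \<and> (\<forall>i\<in>I. \<forall>xs\<in>nlists (ar i) X. xs \<in> \<rho> i \<longleftrightarrow> map f xs \<in> \<sigma> i)"

definition automorphism ::
  "'i set \<Rightarrow> ('i \<Rightarrow> nat) \<Rightarrow> 'a set \<Rightarrow> ('i \<Rightarrow> 'a list set) \<Rightarrow> ('a \<Rightarrow> 'a) \<Rightarrow> bool" where
  "automorphism I ar X \<rho> f \<longleftrightarrow> isomorphism I ar X \<rho> X \<rho> f"

definition interp_iso ::
  "'i set \<Rightarrow> ('i \<Rightarrow> nat) \<Rightarrow> 'a set \<Rightarrow> ('i \<Rightarrow> 'a list set) \<Rightarrow> ('i \<Rightarrow> 'a list set) \<Rightarrow> bool" where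
  "interp_iso I ar X \<rho> \<sigma> \<longleftrightarrow> (\<exists>f. isomorphism I ar X \<rho> X \<sigma> f)"

definition iso_class ::
  "'i set \<Rightarrow> ('i \<Rightarrow> nat) \<Rightarrow> 'a set \<Rightarrow> ('i \<Rightarrow> 'a list set) \<Rightarrow> ('i \<Rightarrow> 'a list set) set" where
  "iso_class I ar X \<rho> = {\<sigma> \<in> Interps I ar X. interp_iso I ar X \<sigma> \<rho>}"

definition iso_invariant ::
  "'i set \<Rightarrow> ('i \<Rightarrow> nat) \<Rightarrow> 'a set \<Rightarrow> ('i \<Rightarrow> 'a list set) set \<Rightarrow> bool" where
  "iso_invariant I ar X C \<longleftrightarrow> (\<forall>\<rho>\<in>C. iso_class I ar X \<rho> \<subseteq> C)"

definition cond_le ::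
  "'i set \<Rightarrow> ('i \<Rightarrow> nat) \<Rightarrow> 'a set \<Rightarrow> ('i \<Rightarrow> 'a list set) \<Rightarrow> ('i \<Rightarrow> 'a list set) \<Rightarrow> bool" where
  "cond_le I ar X \<rho> \<sigma> \<longleftrightarrow> (\<exists>f. condensation I ar X \<rho> X \<sigma> f)"

definition cond_equiv ::
  "'i set \<Rightarrow> ('i \<Rightarrow> nat) \<Rightarrow> 'a set \<Rightarrow> ('i \<Rightarrow> 'a list set) \<Rightarrow> ('i \<Rightarrow> 'a list set) \<Rightarrow> bool" where
  "cond_equiv I ar X \<rho> \<sigma> \<longleftrightarrow> cond_le I ar X \<rho> \<sigma> \<and> cond_le I ar X \<sigma> \<rho>"

definition cond_class ::
  "'i set \<Rightarrow> ('i \<Rightarrow> nat) \<Rightarrow> 'a set \<Rightarrow> ('i \<Rightarrow> 'a list set) \<Rightarrow> ('i \<Rightarrow> 'a list set) set" where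
  "cond_class I ar X \<rho> = {\<sigma> \<in> Interps I ar X. cond_equiv I ar X \<sigma> \<rho>}"

definition reversible ::
  "'i set \<Rightarrow> ('i \<Rightarrow> nat) \<Rightarrow> 'a set \<Rightarrow> ('i \<Rightarrow> 'a list set) \<Rightarrow> bool" where
  "reversible I ar X \<rho> \<longleftrightarrow>
     (\<forall>f. condensation I ar X \<rho> X \<rho> f \<longrightarrow> automorphism I ar X \<rho> f)"

end

(* Over a fixed carrier, a bijection f is a condensation from \<rho> to \<sigma> iff \<rho> lies below the
   pullback of \<sigma> along f, and an isomorphism iff it equals that pullback. Pulling back is
   monotone and does not leave an isomorphism-invariant class, so maximality of \<tau> turns
   \<tau> \<subseteq> f*\<tau> into an equality; for minimal \<tau> the inverse of f plays this role.
   Reversibility then gives (b), because a condensation f with a condensation g in the other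
   direction is an isomorphism as soon as the composite of g and f is one. *)

theory Submission
  imports Defs
begin

section \<open>Pullbacks of interpretations along maps\<close>

definition interp_pull ::
  "'i set \<Rightarrow> ('i \<Rightarrow> nat) \<Rightarrow> 'a set \<Rightarrow> ('a \<Rightarrow> 'b) \<Rightarrow> ('i \<Rightarrow> 'b list set) \<Rightarrow> ('i \<Rightarrow> 'a list set)" where
  "interp_pull I ar X f \<sigma> = (\<lambda>i\<in>I. {xs \<in> nlists (ar i) X. map f xs \<in> \<sigma> i})"

lemma map_in_nlists: "f \<in> X \<rightarrow> Y \<Longrightarrow> xs \<in> nlists n X \<Longrightarrow> map f xs \<in> nlists n Y"
  unfolding nlists_def by auto

lemma Interps_nlists: "\<rho> \<in> Interps I ar X \<Longrightarrow> i \<in> I \<Longrightarrow> xs \<in> \<rho> i \<Longrightarrow> xs \<in> nlists (ar i) X"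
  by (auto simp: Interps_def PiE_iff)

lemma Interps_eqI:
  assumes "\<rho> \<in> Interps I ar X" "\<sigma> \<in> Interps I ar X"
    and "\<And>i xs. i \<in> I \<Longrightarrow> xs \<in> nlists (ar i) X \<Longrightarrow> xs \<in> \<rho> i \<longleftrightarrow> xs \<in> \<sigma> i"
  shows "\<rho> = \<sigma>"
proof (rule PiE_ext)
  show "\<rho> \<in> (\<Pi>\<^sub>E i\<in>I. Pow (nlists (ar i) X))" "\<sigma> \<in> (\<Pi>\<^sub>E i\<in>I. Pow (nlists (ar i) X))"
    using assms(1,2) by (simp_all add: Interps_def)
  show "\<rho> i = \<sigma> i" if "i \<in> I" for i
    using assms(3)[OF that] Interps_nlists[OF assms(1) that] Interps_nlists[OF assms(2) that]
    by blast
qed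

text \<open>Cutting down to lists over \<open>X\<close> and restricting to \<open>I\<close> in
  \<open>interp_pull\<close> make this true for arbitrary \<open>f\<close> and \<sigma>. Isomorphism
  can then be expressed by a literal equation between families.\<close>

lemma interp_pull_in_Interps: "interp_pull I ar X f \<sigma> \<in> Interps I ar X"
  by (auto simp: interp_pull_def Interps_def)

lemma interp_pull_mono:
  "interp_le I \<rho> \<sigma> \<Longrightarrow> interp_le I (interp_pull I ar X f \<rho>) (interp_pull I ar X f \<sigma>)"
  by (auto simp: interp_pull_def interp_le_def)

text \<open>Pulling back along \<open>g\<close> and then along \<open>f\<close> amounts to pulling
  back along the composite of \<open>f\<close> followed by \<open>g\<close>. That composite fixes
  every point of \<open>X\<close>, hence every list over \<open>X\<close>, and \<sigma> contains no
  other lists.\<close>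

lemma interp_pull_inverse:
  assumes "\<sigma> \<in> Interps I ar X" "f \<in> X \<rightarrow> X" "\<And>x. x \<in> X \<Longrightarrow> g (f x) = x"
  shows "interp_pull I ar X f (interp_pull I ar X g \<sigma>) = \<sigma>"
proof (rule Interps_eqI[OF interp_pull_in_Interps assms(1)])
  fix i xs assume "i \<in> I" and xs: "xs \<in> nlists (ar i) X"
  moreover from xs have "map g (map f xs) = xs"
    using subsetD[OF nlistsE_set[OF xs]] by (auto intro!: map_idI assms(3))
  ultimately show "xs \<in> interp_pull I ar X f (interp_pull I ar X g \<sigma>) i \<longleftrightarrow> xs \<in> \<sigma> i"
    using map_in_nlists[OF assms(2) xs] by (simp add: interp_pull_def)
qed

text \<open>An isomorphism only compares lists over \<open>X\<close> at indices in \<open>I\<close>.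
  Membership of \<rho> in \<open>Interps\<close> fixes it everywhere else, so this agreement is
  already equality.\<close>

lemma isomorphism_iff_pull:
  assumes "\<rho> \<in> Interps I ar X"
  shows "isomorphism I ar X \<rho> Y \<sigma> f \<longleftrightarrow> bij_betw f X Y \<and> \<rho> = interp_pull I ar X f \<sigma>"
proof -
  have "\<rho> = interp_pull I ar X f \<sigma>"
    if "\<forall>i\<in>I. \<forall>xs\<in>nlists (ar i) X. xs \<in> \<rho> i \<longleftrightarrow> map f xs \<in> \<sigma> i"
    by (rule Interps_eqI[OF assms interp_pull_in_Interps]) (use that in \<open>auto simp: interp_pull_def\<close>)
  then show ?thesis
    by (auto simp: isomorphism_def interp_pull_def)
qed

lemma condensation_iff_pull:
  assumes "\<rho> \<in> Interps I ar X"
  shows "condensation I ar X \<rho> Y \<sigma> f \<longleftrightarrow> bij_betw f X Y \<and> interp_le I \<rho> (interp_pull I ar X f \<sigma>)"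
  using Interps_nlists[OF assms]
  by (auto simp: condensation_def homomorphism_def interp_le_def interp_pull_def bij_betw_def)

section \<open>Isomorphism against mutual condensation\<close>

lemma isomorphism_imp_condensation:
  "isomorphism I ar X \<rho> Y \<sigma> f \<Longrightarrow> condensation I ar X \<rho> Y \<sigma> f"
  by (auto simp: isomorphism_def condensation_def homomorphism_def bij_betw_def)

lemma isomorphism_inv_into:
  assumes "isomorphism I ar X \<rho> Y \<sigma> f"
  shows "isomorphism I ar Y \<sigma> X \<rho> (inv_into X f)"
proof -
  from assms have bij: "bij_betw f X Y"
    by (simp add: isomorphism_def)
  note inv = bij_betw_inv_into[OF bij]
  have iff: "\<And>i xs. i \<in> I \<Longrightarrow> xs \<in> nlists (ar i) X \<Longrightarrow> xs \<in> \<rho> i \<longleftrightarrow> map f xs \<in> \<sigma> i"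
    using assms by (simp add: isomorphism_def)
  have "ys \<in> \<sigma> i \<longleftrightarrow> map (inv_into X f) ys \<in> \<rho> i" if "i \<in> I" "ys \<in> nlists (ar i) Y" for i ys
  proof -
    have "map (inv_into X f) ys \<in> nlists (ar i) X"
      by (rule map_in_nlists[OF bij_betw_imp_funcset[OF inv] that(2)])
    moreover have "map f (map (inv_into X f) ys) = ys"
      unfolding map_map
      using subsetD[OF nlistsE_set[OF that(2)]]
      by (auto intro!: map_idI bij_betw_inv_into_right[OF bij])
    ultimately show ?thesis
      using iff[OF that(1)] by simp
  qed
  with inv show ?thesis
    by (simp add: isomorphism_def)
qed

lemma condensation_comp:
  assumes "condensation I ar X \<rho> Y \<sigma> f" "condensation I ar Y \<sigma> Z \<tau> g"
  shows "condensation I ar X \<rho> Z \<tau> (g \<circ> f)"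
proof -
  have "map (g \<circ> f) xs \<in> \<tau> i" if "i \<in> I" "xs \<in> nlists (ar i) X" "xs \<in> \<rho> i" for i xs
  proof -
    have "map f xs \<in> nlists (ar i) Y" "map f xs \<in> \<sigma> i"
      using assms(1) that map_in_nlists[of f X Y]
      by (auto simp: condensation_def homomorphism_def)
    then have "map g (map f xs) \<in> \<tau> i"
      using assms(2) that(1) by (auto simp: condensation_def homomorphism_def simp del: map_map)
    then show ?thesis
      by simp
  qed
  moreover have "bij_betw (g \<circ> f) X Z"
    using assms by (auto simp: condensation_def intro: bij_betw_trans)
  ultimately show ?thesis
    using bij_betw_imp_funcset[of "g \<circ> f" X Z] by (simp add: condensation_def homomorphism_def)
qed

text \<open>What a condensation lacks is reflection of the relations. If \<open>map f xs\<close>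
  lies in \<sigma>, then \<open>g\<close> carries it into \<tau>; this image is also the image of
  \<open>xs\<close> under the automorphism \<open>g \<circ> f\<close>, which reflects membership
  back to \<open>xs\<close>.\<close>

lemma reversible_condensation_isomorphism:
  assumes "reversible I ar X \<tau>"
    and f: "condensation I ar X \<tau> Y \<sigma> f" and g: "condensation I ar Y \<sigma> X \<tau> g"
  shows "isomorphism I ar X \<tau> Y \<sigma> f"
proof -
  have gf: "isomorphism I ar X \<tau> X \<tau> (g \<circ> f)"
    using assms condensation_comp[OF f g] by (auto simp: reversible_def automorphism_def)
  have "xs \<in> \<tau> i" if "i \<in> I" and xs: "xs \<in> nlists (ar i) X" and "map f xs \<in> \<sigma> i" for i xs
  proof -
    have "map f xs \<in> nlists (ar i) Y"
      using f xs by (auto simp: condensation_def homomorphism_def intro: map_in_nlists)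
    then have "map g (map f xs) \<in> \<tau> i"
      using g that by (auto simp: condensation_def homomorphism_def simp del: map_map)
    then show ?thesis
      using gf that by (auto simp: isomorphism_def)
  qed
  then show ?thesis
    using f by (auto simp: isomorphism_def condensation_def homomorphism_def)
qed

lemma reversible_iso_class_eq_cond_class:
  assumes "reversible I ar X \<tau>"
  shows "iso_class I ar X \<tau> = cond_class I ar X \<tau>"
proof -
  have "interp_iso I ar X \<sigma> \<tau> \<longleftrightarrow> cond_equiv I ar X \<sigma> \<tau>" for \<sigma>
    \<comment> \<open>Inverse maps serve both directions: an isomorphism and its inverse are the two
      condensations required, while conversely reversibility makes the condensation from \<tau> to
      \<sigma> an isomorphism, which is then inverted to lead into \<tau>.\<close>
    unfolding interp_iso_def cond_equiv_def cond_le_def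
    using isomorphism_imp_condensation isomorphism_inv_into
      reversible_condensation_isomorphism[OF assms] by meson
  then show ?thesis
    by (simp add: iso_class_def cond_class_def)
qed

section \<open>Isomorphism classes of maximal and minimal elements\<close>

lemma iso_class_iff_pull:
  "\<sigma> \<in> iso_class I ar X \<tau> \<longleftrightarrow> (\<exists>f. bij_betw f X X \<and> \<sigma> = interp_pull I ar X f \<tau>)"
  \<comment> \<open>The isomorphism leads from the member \<sigma> to \<tau>, so the pullback is
    along that map itself, and \<open>isomorphism_iff_pull\<close> is applied to \<sigma>, which
    lies in \<open>Interps\<close> on either side.\<close>
  by (auto simp: iso_class_def interp_iso_def isomorphism_iff_pull interp_pull_in_Interps)

lemma iso_invariant_pull:
  "iso_invariant I ar X C \<Longrightarrow> \<rho> \<in> C \<Longrightarrow> bij_betw f X X \<Longrightarrow> interp_pull I ar X f \<rho> \<in> C"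
  unfolding iso_invariant_def using iso_class_iff_pull by blast

lemma reversible_Max_interps:
  assumes "C \<subseteq> Interps I ar X" "iso_invariant I ar X C" "\<tau> \<in> Max_interps I C"
  shows "reversible I ar X \<tau>"
  unfolding reversible_def automorphism_def
proof (intro allI impI)
  fix f assume f: "condensation I ar X \<tau> X \<tau> f"
  have \<tau>: "\<tau> \<in> C" "\<tau> \<in> Interps I ar X"
    using assms by (auto simp: Max_interps_def)
  have bij: "bij_betw f X X" and "interp_le I \<tau> (interp_pull I ar X f \<tau>)"
    using f condensation_iff_pull[OF \<tau>(2)] by auto
  then have "interp_pull I ar X f \<tau> = \<tau>"
    using assms(3) iso_invariant_pull[OF assms(2) \<tau>(1) bij] by (auto simp: Max_interps_def)
  then show "isomorphism I ar X \<tau> X \<tau> f"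
    using bij isomorphism_iff_pull[OF \<tau>(2)] by metis
qed

lemma bij_betw_pull_inv_into:
  assumes "bij_betw f X X" "\<sigma> \<in> Interps I ar X"
  shows "interp_pull I ar X f (interp_pull I ar X (inv_into X f) \<sigma>) = \<sigma>"
    and "interp_pull I ar X (inv_into X f) (interp_pull I ar X f \<sigma>) = \<sigma>"
  using assms bij_betw_inv_into[OF assms(1)]
  by (auto intro!: interp_pull_inverse simp: bij_betw_inv_into_left bij_betw_inv_into_right
      dest: bij_betwE)

lemma reversible_Min_interps:
  assumes "C \<subseteq> Interps I ar X" "iso_invariant I ar X C" "\<tau> \<in> Min_interps I C"
  shows "reversible I ar X \<tau>"
  unfolding reversible_def automorphism_def
proof (intro allI impI)
  fix f assume f: "condensation I ar X \<tau> X \<tau> f"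
  let ?g = "inv_into X f"
  have \<tau>: "\<tau> \<in> C" "\<tau> \<in> Interps I ar X"
    using assms by (auto simp: Min_interps_def)
  have bij: "bij_betw f X X" and "interp_le I \<tau> (interp_pull I ar X f \<tau>)"
    using f condensation_iff_pull[OF \<tau>(2)] by auto
  \<comment> \<open>The inclusion above places \<tau> on the smaller side, where minimality says
    nothing. Pulling both sides back along the inverse cancels \<open>f\<close> on the right and
    leaves \<tau> as the larger side.\<close>
  from interp_pull_mono[OF this(2), of ar X ?g]
  have "interp_le I (interp_pull I ar X ?g \<tau>) \<tau>"
    by (simp add: bij_betw_pull_inv_into(2)[OF bij \<tau>(2)])
  then have "interp_pull I ar X ?g \<tau> = \<tau>"
    using assms(3) iso_invariant_pull[OF assms(2) \<tau>(1) bij_betw_inv_into[OF bij]]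
    by (auto simp: Min_interps_def)
  then have "\<tau> = interp_pull I ar X f \<tau>"
    using bij_betw_pull_inv_into(1)[OF bij \<tau>(2)] by simp
  then show "isomorphism I ar X \<tau> X \<tau> f"
    using bij isomorphism_iff_pull[OF \<tau>(2)] by blast
qed

text \<open>\<open>R\<close> stands for the order or its converse, so one argument covers maximal
  and minimal \<tau>. A competitor \<sigma> of \<rho> is moved back along the inverse of
  \<open>f\<close> to a competitor of \<tau> inside \<open>C\<close>; this must be \<tau> itself,
  and pulling back along \<open>f\<close> recovers \<sigma> as \<rho>.\<close>

lemma iso_class_extremal:
  assumes "C \<subseteq> Interps I ar X" "iso_invariant I ar X C"
    and mono: "\<And>f \<rho> \<sigma>. R \<rho> \<sigma> \<Longrightarrow> R (interp_pull I ar X f \<rho>) (interp_pull I ar X f \<sigma>)"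
    and \<tau>: "\<tau> \<in> C" "\<And>\<sigma>. \<sigma> \<in> C \<Longrightarrow> R \<tau> \<sigma> \<Longrightarrow> \<sigma> = \<tau>"
    and \<rho>: "\<rho> \<in> iso_class I ar X \<tau>" and \<sigma>: "\<sigma> \<in> C" "R \<rho> \<sigma>"
  shows "\<sigma> = \<rho>"
proof -
  obtain f where f: "bij_betw f X X" and \<rho>_eq: "\<rho> = interp_pull I ar X f \<tau>"
    using \<rho> iso_class_iff_pull by blast
  let ?g = "inv_into X f"
  have "interp_pull I ar X ?g \<rho> = \<tau>"
    unfolding \<rho>_eq using assms(1) \<tau>(1) by (intro bij_betw_pull_inv_into(2)[OF f]) blast
  with mono[OF \<sigma>(2), of ?g] have "R \<tau> (interp_pull I ar X ?g \<sigma>)"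
    by simp
  then have "interp_pull I ar X ?g \<sigma> = \<tau>"
    using \<tau>(2) iso_invariant_pull[OF assms(2) \<sigma>(1) bij_betw_inv_into[OF f]] by blast
  moreover have "interp_pull I ar X f (interp_pull I ar X ?g \<sigma>) = \<sigma>"
    using assms(1) \<sigma>(1) by (intro bij_betw_pull_inv_into(1)[OF f]) blast
  ultimately show ?thesis
    by (simp add: \<rho>_eq)
qed

lemma iso_class_subset_Max_interps:
  assumes "C \<subseteq> Interps I ar X" "iso_invariant I ar X C" "\<tau> \<in> Max_interps I C"
  shows "iso_class I ar X \<tau> \<subseteq> Max_interps I C"
proof
  fix \<rho> assume \<rho>: "\<rho> \<in> iso_class I ar X \<tau>"
  have \<tau>: "\<tau> \<in> C" "\<And>\<sigma>. \<sigma> \<in> C \<Longrightarrow> interp_le I \<tau> \<sigma> \<Longrightarrow> \<sigma> = \<tau>"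
    using assms(3) by (auto simp: Max_interps_def)
  then have "\<rho> \<in> C"
    using assms(2) \<rho> by (auto simp: iso_invariant_def)
  with iso_class_extremal[OF assms(1,2), of "interp_le I", OF interp_pull_mono \<tau> \<rho>]
  show "\<rho> \<in> Max_interps I C"
    by (simp add: Max_interps_def)
qed

lemma iso_class_subset_Min_interps:
  assumes "C \<subseteq> Interps I ar X" "iso_invariant I ar X C" "\<tau> \<in> Min_interps I C"
  shows "iso_class I ar X \<tau> \<subseteq> Min_interps I C"
proof
  fix \<rho> assume \<rho>: "\<rho> \<in> iso_class I ar X \<tau>"
  have \<tau>: "\<tau> \<in> C" "\<And>\<sigma>. \<sigma> \<in> C \<Longrightarrow> interp_le I \<sigma> \<tau> \<Longrightarrow> \<sigma> = \<tau>"
    using assms(3) by (auto simp: Min_interps_def)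
  then have "\<rho> \<in> C"
    using assms(2) \<rho> by (auto simp: iso_invariant_def)
  with iso_class_extremal[OF assms(1,2), of "\<lambda>\<rho> \<sigma>. interp_le I \<sigma> \<rho>", OF interp_pull_mono \<tau> \<rho>]
  show "\<rho> \<in> Min_interps I C"
    by (simp add: Min_interps_def)
qed

lemma antichain_in_Max_interps: "A \<subseteq> Max_interps I C \<Longrightarrow> antichain_in I C A"
  unfolding antichain_in_def Max_interps_def by blast

lemma antichain_in_Min_interps: "A \<subseteq> Min_interps I C \<Longrightarrow> antichain_in I C A"
  unfolding antichain_in_def Min_interps_def by blast

section \<open>Complements and the exchange of maximal and minimal\<close>

lemma interp_pull_compl:
  assumes "f \<in> X \<rightarrow> X"
  shows "interp_pull I ar X f (interp_compl I ar X \<rho>) = interp_compl I ar X (interp_pull I ar X f \<rho>)"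
  \<comment> \<open>For \<open>xs\<close> over \<open>X\<close> the image \<open>map f xs\<close> is
    again over \<open>X\<close>, so it lies in the complement exactly when it avoids \<rho>.\<close>
  using map_in_nlists[OF assms] by (auto simp: interp_pull_def interp_compl_def fun_eq_iff)

lemma interp_compl_compl:
  "\<rho> \<in> Interps I ar X \<Longrightarrow> interp_compl I ar X (interp_compl I ar X \<rho>) = \<rho>"
  by (rule Interps_eqI) (auto simp: interp_compl_def Interps_def)

lemma interp_le_compl_iff:
  assumes "\<rho> \<in> Interps I ar X" "\<sigma> \<in> Interps I ar X"
  shows "interp_le I (interp_compl I ar X \<sigma>) (interp_compl I ar X \<rho>) \<longleftrightarrow> interp_le I \<rho> \<sigma>"
  \<comment> \<open>To get back from the complements: a list in \<rho> is over \<open>X\<close>, so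
    if it missed \<sigma> it would lie in the complement of \<sigma> and hence in that of
    \<rho>.\<close>
  using Interps_nlists[OF assms(1)] by (fastforce simp: interp_le_def interp_compl_def)

lemma iso_invariant_compl:
  assumes "iso_invariant I ar X C"
  shows "iso_invariant I ar X (interp_compl I ar X ` C)"
  unfolding iso_invariant_def
proof (intro ballI subsetI)
  fix \<rho>' \<sigma> assume "\<rho>' \<in> interp_compl I ar X ` C" "\<sigma> \<in> iso_class I ar X \<rho>'"
  then obtain \<rho> f where "\<rho> \<in> C" and f: "bij_betw f X X"
    and \<sigma>: "\<sigma> = interp_pull I ar X f (interp_compl I ar X \<rho>)"
    using iso_class_iff_pull by blast
  moreover have "f \<in> X \<rightarrow> X"
    using f by (auto simp: bij_betw_def)
  ultimately show "\<sigma> \<in> interp_compl I ar X ` C"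
    \<comment> \<open>Since pullback commutes with complement, \<sigma> is the complement of a
      pullback of \<rho>, and that pullback stays in \<open>C\<close>.\<close>
    using iso_invariant_pull[OF assms] by (simp add: interp_pull_compl)
qed

lemma Max_interps_iff_compl_Min_interps:
  assumes "C \<subseteq> Interps I ar X" "\<tau> \<in> Interps I ar X"
  shows "\<tau> \<in> Max_interps I C \<longleftrightarrow>
    interp_compl I ar X \<tau> \<in> Min_interps I (interp_compl I ar X ` C)"
proof -
  \<comment> \<open>An involution is injective. Hence the complement of \<tau> can enter the image
    of \<open>C\<close> only through \<tau> itself, which matters because \<tau> ranges over all
    interpretations.\<close>
  have inj: "interp_compl I ar X \<sigma> = interp_compl I ar X \<tau> \<longleftrightarrow> \<sigma> = \<tau>" if "\<sigma> \<in> C" for \<sigma>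
    using that assms interp_compl_compl by (metis subsetD)
  moreover from this have "interp_compl I ar X \<tau> \<in> interp_compl I ar X ` C \<longleftrightarrow> \<tau> \<in> C"
    by (metis (no_types, lifting) image_iff)
  moreover have "interp_le I (interp_compl I ar X \<sigma>) (interp_compl I ar X \<tau>) \<longleftrightarrow> interp_le I \<tau> \<sigma>"
    if "\<sigma> \<in> C" for \<sigma>
    using that assms by (intro interp_le_compl_iff) auto
  ultimately show ?thesis
    by (simp add: Max_interps_def Min_interps_def)
qed

theorem theorem3p1:
  fixes I :: "'i set" and ar :: "'i \<Rightarrow> nat" and X :: "'a set"
    and C :: "('i \<Rightarrow> 'a list set) set"
  assumes "X \<noteq> {}"
    and "C \<subseteq> Interps I ar X"
    and "iso_invariant I ar X C"
  shows "(\<forall>\<tau> \<in> Max_interps I C.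
            reversible I ar X \<tau> \<and>
            iso_class I ar X \<tau> = cond_class I ar X \<tau> \<and>
            antichain_in I C (iso_class I ar X \<tau>) \<and>
            iso_class I ar X \<tau> \<subseteq> Max_interps I C) \<and>
         (\<forall>\<tau> \<in> Min_interps I C.
            reversible I ar X \<tau> \<and>
            iso_class I ar X \<tau> = cond_class I ar X \<tau> \<and>
            antichain_in I C (iso_class I ar X \<tau>) \<and>
            iso_class I ar X \<tau> \<subseteq> Min_interps I C) \<and>
         iso_invariant I ar X (interp_compl I ar X ` C) \<and>
         (\<forall>\<tau> \<in> Interps I ar X.
            \<tau> \<in> Max_interps I C \<longleftrightarrow>
            interp_compl I ar X \<tau> \<in> Min_interps I (interp_compl I ar X ` C))"
proof (intro conjI ballI)
  fix \<tau> assume \<tau>: "\<tau> \<in> Max_interps I C"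
  show rev: "reversible I ar X \<tau>"
    by (rule reversible_Max_interps[OF assms(2,3) \<tau>])
  show "iso_class I ar X \<tau> = cond_class I ar X \<tau>"
    by (rule reversible_iso_class_eq_cond_class[OF rev])
  show sub: "iso_class I ar X \<tau> \<subseteq> Max_interps I C"
    by (rule iso_class_subset_Max_interps[OF assms(2,3) \<tau>])
  show "antichain_in I C (iso_class I ar X \<tau>)"
    by (rule antichain_in_Max_interps[OF sub])
next
  fix \<tau> assume \<tau>: "\<tau> \<in> Min_interps I C"
  show rev: "reversible I ar X \<tau>"
    by (rule reversible_Min_interps[OF assms(2,3) \<tau>])
  show "iso_class I ar X \<tau> = cond_class I ar X \<tau>"
    by (rule reversible_iso_class_eq_cond_class[OF rev])
  show sub: "iso_class I ar X \<tau> \<subseteq> Min_interps I C"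
    by (rule iso_class_subset_Min_interps[OF assms(2,3) \<tau>])
  show "antichain_in I C (iso_class I ar X \<tau>)"
    by (rule antichain_in_Min_interps[OF sub])
next
  show "iso_invariant I ar X (interp_compl I ar X ` C)"
    by (rule iso_invariant_compl[OF assms(3)])
next
  fix \<tau> assume "\<tau> \<in> Interps I ar X"
  then show "\<tau> \<in> Max_interps I C \<longleftrightarrow>
      interp_compl I ar X \<tau> \<in> Min_interps I (interp_compl I ar X ` C)"
    by (rule Max_interps_iff_compl_Min_interps[OF assms(2)])
qed

end
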